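(* Let $m$ be odd, let $n=2^m-1$ and let $\beta$ be a primitive $n$-th root of unity in $\mathbb{F}_{2^m}$. Put $\delta=2^{\frac{m+1}{2}}-3$ and assume $\delta\ge 2$. Let $g(x)$ be the generator polynomial of the binary BCH code $\mathcal{C}_{(2,n,\delta,1,\beta)}$, let $h(x)=(x^n-1)/g(x)$, let $g^\perp(x)=x^{\deg h(x)}h(x^{-1})/h(0)$ be the generator polynomial of $\mathcal{C}_{(2,n,\delta,1,\beta)}^\perp$, and let $\mathbf{T}_{g^\perp}=\{i\in\{0,1,\dots,n-1\}:g^\perp(\beta^i)=0\}$ be its defining set. Then, for $m\ge5$, $$\{0,1,\dots,2^{\frac{m+1}{2}}-2\}\cup\{2^{\frac{m+1}{2}},2^{\frac{m+1}{2}}+1,\dots,2^{\frac{m+3}{2}}-4\}\subseteq \mathbf{T}_{g^\perp}.$$ Moreover, in the case $m=5$, also $2^{\frac{m+3}{2}}-3\in \mathbf{T}_{g^\perp}$.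
   Context: The Euclidean dual of a linear code $\mathcal{C}\subseteq\mathbb{F}_q^n$ is $\mathcal{C}^\perp=\{c\in\mathbb{F}_q^n:\sum_i c_iy_i=0\ \forall y\in\mathcal{C}\}$. A cyclic code of length $n$ over $\mathbb{F}_q$ is identified with an ideal of $\mathbb{F}_q[x]/\langle x^n-1\rangle$; its generator polynomial is the unique monic divisor of $x^n-1$ generating it. For $\gcd(n,q)=1$ and $\beta$ a primitive $n$-th root of unity, $m_{\beta^i}(x)$ denotes the minimal polynomial of $\beta^i$ over $\mathbb{F}_q$. For integers $\delta\ge2$ and $b$, the BCH code $\mathcal{C}_{(q,n,\delta,b,\beta)}$ is the cyclic code of length $n$ over $\mathbb{F}_q$ with generator polynomial $\mathrm{lcm}\{m_{\beta^b}(x),\dots,m_{\beta^{b+\delta-2}}(x)\}$. *)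

theory Defs
  imports
    "HOL-Library.Cardinality"
    "HOL-Number_Theory.Cong"
    "HOL-Computational_Algebra.Polynomial_Factorial"
    "Jordan_Normal_Form.Matrix"
begin

(* The ground field F_q is the type 'k, the extension field containing the roots of unity is 'e,
   and emb :: 'k => 'e is the inclusion. The class field_gcd is used for 'k because the library
   provides Lcm on 'k poly only for it; every field can be made an instance. *)

definition primitive_root_of_unity :: "nat \<Rightarrow> 'e::field \<Rightarrow> bool" where
  "primitive_root_of_unity n \<beta> \<longleftrightarrow>
     n > 0 \<and> \<beta> ^ n = 1 \<and> (\<forall>k. 0 < k \<and> k < n \<longrightarrow> \<beta> ^ k \<noteq> 1)"

definition is_min_poly :: "('k::field \<Rightarrow> 'e::field) \<Rightarrow> 'e \<Rightarrow> 'k poly \<Rightarrow> bool" where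
  "is_min_poly emb \<alpha> p \<longleftrightarrow>
     lead_coeff p = 1 \<and> poly (map_poly emb p) \<alpha> = 0 \<and>
     (\<forall>r. r \<noteq> 0 \<and> poly (map_poly emb r) \<alpha> = 0 \<longrightarrow> degree p \<le> degree r)"

definition min_poly :: "('k::field \<Rightarrow> 'e::field) \<Rightarrow> 'e \<Rightarrow> 'k poly" where
  "min_poly emb \<alpha> = (THE p. is_min_poly emb \<alpha> p)"

(* The word (c_0, ..., c_{n-1}) stands for the class of c_0 + c_1 x + ... + c_{n-1} x^{n-1}
   modulo x^n - 1; this is the set of words of the ideal generated by the class of g. *)
definition cyclic_code :: "nat \<Rightarrow> 'k::field poly \<Rightarrow> 'k vec set" where
  "cyclic_code n g =
     {c \<in> carrier_vec n. \<exists>a. [Poly (list_of_vec c) = a * g] (mod (monom 1 n - 1))}"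

definition is_generator_poly :: "nat \<Rightarrow> 'k::field vec set \<Rightarrow> 'k poly \<Rightarrow> bool" where
  "is_generator_poly n C g \<longleftrightarrow>
     lead_coeff g = 1 \<and> g dvd (monom 1 n - 1) \<and> C = cyclic_code n g"

definition dual_code :: "nat \<Rightarrow> 'k::field vec set \<Rightarrow> 'k vec set" where
  "dual_code n C = {c \<in> carrier_vec n. \<forall>y\<in>C. c \<bullet> y = 0}"

(* Lcm of polynomials over a field is normalized, i.e. monic. *)
definition bch_code ::
  "('k::field_gcd \<Rightarrow> 'e::field) \<Rightarrow> nat \<Rightarrow> int \<Rightarrow> int \<Rightarrow> 'e \<Rightarrow> 'k vec set" where
  "bch_code emb n \<delta> b \<beta> =
     cyclic_code n (Lcm ((\<lambda>i. min_poly emb (\<beta> powi i)) ` {b..b + \<delta> - 2}))"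

definition defining_set :: "('k::field \<Rightarrow> 'e::field) \<Rightarrow> nat \<Rightarrow> 'e \<Rightarrow> 'k poly \<Rightarrow> nat set" where
  "defining_set emb n \<beta> p = {i \<in> {0..<n}. poly (map_poly emb p) (\<beta> ^ i) = 0}"

(* x^(deg h) h(1/x) / h(0), where reflect_poly reverses the list of coefficients *)
definition monic_reciprocal :: "'k::field poly \<Rightarrow> 'k poly" where
  "monic_reciprocal h = Polynomial.smult (inverse (poly h 0)) (reflect_poly h)"

end

theory Submission
  imports Defs "Subresultants.More_Homomorphisms"
begin

text \<open>
  A word \<open>c\<close> is orthogonal to the cyclic code of \<open>g\<close> iff \<open>h\<close> divides the polynomial of the reversed
  word, because the inner product of \<open>c\<close> and \<open>y\<close> is the coefficient of \<open>x\<^sup>n\<^sup>-\<^sup>1\<close> in the product of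
  the reversed \<open>c\<close> and \<open>y\<close>; hence the dual code is generated by the reciprocal of \<open>h\<close>.

  The reciprocal of \<open>h\<close> vanishes at \<open>\<beta>\<^sup>i\<close> as soon as \<open>g\<close> does not vanish at \<open>\<beta>\<^sup>-\<^sup>i\<close>. The roots of \<open>g\<close>
  are powers \<open>\<beta> ^ (j * 2 ^ l)\<close> with \<open>1 \<le> j < \<delta>\<close> and \<open>l < m\<close>, so it remains to see that \<open>n\<close> does not
  divide \<open>i + j * 2 ^ l\<close>. With \<open>m = 2 * q + 3\<close> and \<open>Q = 2 ^ q\<close>, one has \<open>n = 8 * Q\<^sup>2 - 1\<close>,
  \<open>\<delta> = 4 * Q - 3\<close>, and the claim concerns the \<open>i \<le> 8 * Q - 4\<close> other than \<open>4 * Q - 1\<close>. If \<open>l \<le> q\<close> the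
  sum is smaller than \<open>n\<close>; otherwise \<open>n\<close> divides \<open>i * 2 ^ (m - l) + j\<close>, and the size of the quotient
  together with divisibility by \<open>2 ^ (m - l)\<close> leaves only excluded \<open>i\<close>.
\<close>

section \<open>Words of a cyclic code as polynomials\<close>

lemma degree_monom_minus_1:
  assumes "n > 0"
  shows "degree (monom (1::'a::comm_ring_1) n - 1) = n"
  using assms by (intro antisym degree_le le_degree) auto

text \<open>Reduction modulo x^n - 1 does not affect divisibility by one of its divisors, so the
  congruence in the definition becomes plain divisibility.\<close>

lemma mem_cyclic_code_iff:
  assumes "g dvd monom 1 n - 1"
  shows "c \<in> cyclic_code n g \<longleftrightarrow> c \<in> carrier_vec n \<and> g dvd Poly (list_of_vec c)"
proof -
  have "(\<exists>a. [Poly (list_of_vec c) = a * g] (mod (monom 1 n - 1))) \<longleftrightarrow> g dvd Poly (list_of_vec c)"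
  proof
    assume "\<exists>a. [Poly (list_of_vec c) = a * g] (mod (monom 1 n - 1))"
    then obtain a where "monom 1 n - 1 dvd Poly (list_of_vec c) - a * g"
      by (auto simp: cong_iff_dvd_diff)
    with assms have "g dvd Poly (list_of_vec c) - a * g" by (rule dvd_trans)
    then have "g dvd (Poly (list_of_vec c) - a * g) + a * g" by (intro dvd_add) auto
    then show "g dvd Poly (list_of_vec c)" by simp
  next
    assume "g dvd Poly (list_of_vec c)"
    then obtain a where "Poly (list_of_vec c) = a * g" by (metis dvd_def mult.commute)
    then show "\<exists>a. [Poly (list_of_vec c) = a * g] (mod (monom 1 n - 1))" by (metis cong_refl)
  qed
  then show ?thesis by (simp add: cyclic_code_def)
qed

lemma degree_Poly_less:
  assumes "length xs \<le> n" "n > 0"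
  shows "degree (Poly xs) < n"
proof -
  have "degree (Poly xs) \<le> n - 1"
    using assms by (intro degree_le) (auto simp: nth_default_def)
  with \<open>n > 0\<close> show ?thesis by simp
qed

lemma Poly_map_coeff:
  assumes "degree p < n"
  shows "Poly (map (coeff p) [0..<n]) = p"
  using assms by (intro poly_eqI) (auto simp: nth_default_def coeff_eq_0)

section \<open>Reversed words and reciprocal polynomials\<close>

lemma Poly_replicate_0_append: "Poly (replicate e 0 @ xs) = monom 1 e * Poly xs"
  for xs :: "'a::comm_semiring_1 list"
  by (simp add: Poly_append)

text \<open>A word has fixed length, whereas \<open>reflect_poly\<close> reverses only up to the
  degree; the trailing zeros of the word account for the factor x^e.\<close>

lemma Poly_rev_eq_monom_mult:
  fixes xs :: "'a::comm_semiring_1 list"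
  obtains e where "Poly (rev xs) = monom 1 e * reflect_poly (Poly xs)"
proof -
  have "\<exists>e. xs = coeffs (Poly xs) @ replicate e 0"
  proof (induction xs rule: rev_induct)
    case Nil
    then show ?case by simp
  next
    case (snoc x xs)
    show ?case
    proof (cases "x = 0")
      case True
      with snoc show ?thesis by (metis Poly_snoc_zero append.assoc replicate_append_same replicate_Suc)
    next
      case False
      then show ?thesis by (intro exI[of _ 0]) simp
    qed
  qed
  then obtain e where "xs = coeffs (Poly xs) @ replicate e 0" ..
  then have "rev xs = replicate e 0 @ rev (coeffs (Poly xs))"
    by (metis rev_append rev_replicate)
  then have "Poly (rev xs) = monom 1 e * reflect_poly (Poly xs)"
    by (simp only: Poly_replicate_0_append reflect_poly_def)
  then show ?thesis by (rule that)
qed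

lemma reflect_poly_monom [simp]: "a \<noteq> 0 \<Longrightarrow> reflect_poly (monom a e) = [:a:]"
  by (intro poly_eqI) (auto simp: coeff_reflect_poly degree_monom_eq coeff_pCons split: nat.splits)

text \<open>Reflecting twice strips the largest power of x dividing a nonzero polynomial.\<close>

lemma reflect_poly_reflect_poly_dvd: "reflect_poly (reflect_poly p) dvd p"
  for p :: "'a::field poly"
proof (induction p)
  case (pCons a p)
  show ?case
  proof (cases "a = 0")
    case True
    then have "reflect_poly (pCons a p) = reflect_poly p"
      by (simp add: reflect_poly_def cCons_def)
    moreover have "p dvd pCons a p" using True by (metis add_0 dvd_triv_right mult.left_neutral mult_pCons_left smult_0_left)
    ultimately show ?thesis using pCons.IH dvd_trans by metis
  qed simp
qed simp

text \<open>Both directions reflect a factorization: a nonzero constant coefficient makes reflection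
  involutive on \<open>h\<close>, and the power of x coming from trailing zeros disappears under
  reflection.\<close>

lemma dvd_Poly_rev_iff:
  fixes h :: "'a::field poly"
  assumes "coeff h 0 \<noteq> 0"
  shows "h dvd Poly (rev xs) \<longleftrightarrow> reflect_poly h dvd Poly xs"
proof -
  obtain e where e: "Poly (rev xs) = monom 1 e * reflect_poly (Poly xs)" by (rule Poly_rev_eq_monom_mult)
  show ?thesis
  proof
    assume "h dvd Poly (rev xs)"
    then obtain a where "Poly (rev xs) = h * a" ..
    then have "reflect_poly (monom 1 e * reflect_poly (Poly xs)) = reflect_poly h * reflect_poly a"
      by (simp add: reflect_poly_mult flip: e)
    then have "reflect_poly h dvd reflect_poly (reflect_poly (Poly xs))"
      by (simp add: reflect_poly_mult)
    then show "reflect_poly h dvd Poly xs"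
      using reflect_poly_reflect_poly_dvd dvd_trans by blast
  next
    assume "reflect_poly h dvd Poly xs"
    then obtain a where "Poly xs = reflect_poly h * a" ..
    then have "reflect_poly (Poly xs) = h * reflect_poly a"
      using assms by (simp add: reflect_poly_mult)
    then show "h dvd Poly (rev xs)" by (simp add: e)
  qed
qed

section \<open>Duals of cyclic codes\<close>

lemma scalar_prod_eq_coeff:
  assumes "c \<in> carrier_vec n" "y \<in> carrier_vec n" "n > 0"
  shows "c \<bullet> y = coeff (Poly (rev (list_of_vec c)) * Poly (list_of_vec y)) (n - 1)"
proof -
  have "coeff (Poly (rev (list_of_vec c)) * Poly (list_of_vec y)) (n - 1)
      = coeff (Poly (list_of_vec y) * Poly (rev (list_of_vec c))) (n - 1)"
    by (simp add: mult.commute)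
  also have "\<dots> = (\<Sum>i\<le>n - 1. y $ i * c $ i)"
    unfolding coeff_mult using assms
    by (intro sum.cong) (auto simp: nth_default_def rev_nth list_of_vec_index)
  also have "{..n - 1} = {0..<n}" using assms(3) by auto
  finally show ?thesis using assms(2) by (simp add: scalar_prod_def mult.commute)
qed

lemma mem_dual_code_cyclic_code_iff:
  fixes g h :: "'a::field poly"
  assumes "n > 0" and gh: "g * h = monom 1 n - 1"
  shows "c \<in> dual_code n (cyclic_code n g) \<longleftrightarrow>
    c \<in> carrier_vec n \<and> h dvd Poly (rev (list_of_vec c))"
proof (cases "c \<in> carrier_vec n")
  case c: True
  define M :: "'a poly" where "M = monom 1 n - 1"
  define r where "r = Poly (rev (list_of_vec c))"
  define d where "d = degree g"
  have degM: "degree M = n" using \<open>n > 0\<close> by (simp add: M_def degree_monom_minus_1)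
  then have "M \<noteq> 0" using \<open>n > 0\<close> by auto
  have "g \<noteq> 0" "h \<noteq> 0" using gh \<open>M \<noteq> 0\<close> by (auto simp: M_def)
  then have deg: "d + degree h = n" using gh degM by (metis M_def d_def degree_mult_eq)
  have degr: "degree r < n"
    using c \<open>n > 0\<close> unfolding r_def by (intro degree_Poly_less) simp_all
  have "(\<forall>y\<in>cyclic_code n g. c \<bullet> y = 0) \<longleftrightarrow>
    (\<forall>a. degree (g * a) < n \<longrightarrow> coeff (r * (g * a)) (n - 1) = 0)"
  proof (intro iffI allI ballI impI)
    fix a assume "\<forall>y\<in>cyclic_code n g. c \<bullet> y = 0" and "degree (g * a) < n"
    moreover from this have "vec n (coeff (g * a)) \<in> cyclic_code n g"
      using gh by (subst mem_cyclic_code_iff) (auto simp: Poly_map_coeff simp flip: gh)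
    ultimately show "coeff (r * (g * a)) (n - 1) = 0"
      using scalar_prod_eq_coeff[OF c, of "vec n (coeff (g * a))"] \<open>n > 0\<close>
      by (simp add: Poly_map_coeff r_def)
  next
    fix y assume *: "\<forall>a. degree (g * a) < n \<longrightarrow> coeff (r * (g * a)) (n - 1) = 0"
      and "y \<in> cyclic_code n g"
    then have y: "y \<in> carrier_vec n" and "g dvd Poly (list_of_vec y)"
      by (subst (asm) mem_cyclic_code_iff; simp flip: gh)+
    then obtain a where a: "Poly (list_of_vec y) = g * a" by (elim dvdE)
    moreover have "degree (Poly (list_of_vec y)) < n"
      using y \<open>n > 0\<close> by (intro degree_Poly_less) simp_all
    ultimately show "c \<bullet> y = 0" using * scalar_prod_eq_coeff[OF c y \<open>n > 0\<close>] by (simp add: r_def)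
  qed
  also have "\<dots> \<longleftrightarrow> h dvd r"
  proof
    assume *: "\<forall>a. degree (g * a) < n \<longrightarrow> coeff (r * (g * a)) (n - 1) = 0"
    have mid: "coeff (r * g) k = 0" if "d \<le> k" "k < n" for k
    proof -
      \<comment> \<open>Testing against g * x^(n-1-k) reads off coefficient \<open>k\<close> of
        \<open>r * g\<close>; this multiple has degree below \<open>n\<close> exactly because
        \<open>d\<close> <= \<open>k\<close>.\<close>
      have "degree (g * monom 1 (n - 1 - k)) < n"
        using that \<open>g \<noteq> 0\<close> by (simp add: degree_mult_eq degree_monom_eq d_def monom_eq_0_iff)
      with * have "coeff (monom 1 (n - 1 - k) * (r * g)) (n - 1) = 0" by (metis mult.assoc mult.commute)
      moreover have "n - 1 - (n - 1 - k) = k" using that by simp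
      ultimately show ?thesis by (simp add: coeff_monom_mult del: diff_diff_left)
    qed
    \<comment> \<open>The middle coefficients of \<^term>\<open>r * g\<close> vanish, so its remainder modulo
      \<^term>\<open>M\<close> has degree below that of \<^term>\<open>g\<close>, which divides it.\<close>
    define a where "a = poly_shift n (r * g)"
    have deg_rg: "degree (r * g) < n + d"
      using degree_mult_le[of r g] degr by (simp add: d_def)
    define b where "b = r * g - a * M"
    have coeff_a: "coeff a k = coeff (r * g) (k + n)" for k
      by (simp add: a_def coeff_poly_shift)
    have "b = 0"
    proof (rule ccontr)
      assume "b \<noteq> 0"
      have "coeff b k = 0" if "k \<ge> d" for k
      proof -
        \<comment> \<open>Since a * M = x^n * a - a, in degrees from \<open>d\<close> on only the
          shifted copy of \<open>a\<close> survives, and it cancels the coefficients of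
          \<open>r * g\<close> from \<open>n\<close> on.\<close>
        have "coeff a k = 0"
          using that deg_rg by (simp add: coeff_a coeff_eq_0)
        then have "coeff (a * M) k = (if k < n then 0 else coeff a (k - n))"
          by (simp add: M_def right_diff_distrib mult.commute[of a] coeff_monom_mult)
        with mid[OF that] show ?thesis by (simp add: b_def coeff_a)
      qed
      then have "degree b < d"
        by (meson \<open>b \<noteq> 0\<close> leading_coeff_0_iff linorder_not_le)
      moreover have "g dvd b" unfolding b_def M_def gh[symmetric]
        by (intro dvd_diff dvd_mult dvd_mult2 dvd_refl)
      ultimately show False using \<open>b \<noteq> 0\<close> dvd_imp_degree_le[of g b] by (simp add: d_def)
    qed
    then have "r * g = a * (g * h)" by (simp add: b_def M_def gh)
    then have "g * r = g * (h * a)" by (simp only: ac_simps)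
    with \<open>g \<noteq> 0\<close> show "h dvd r" by simp
  next
    assume "h dvd r"
    then obtain q where q: "r = h * q" ..
    show "\<forall>a. degree (g * a) < n \<longrightarrow> coeff (r * (g * a)) (n - 1) = 0"
    proof (intro allI impI)
      fix a assume dega: "degree (g * a) < n"
      have "r * (g * a) = (g * h) * (q * a)" by (simp only: q ac_simps)
      also have "\<dots> = monom 1 n * (q * a) - q * a" by (simp only: gh left_diff_distrib mult_1)
      finally have "coeff (r * (g * a)) (n - 1) = - coeff (q * a) (n - 1)"
        using \<open>n > 0\<close> by (simp add: coeff_monom_mult)
      moreover have "coeff (q * a) (n - 1) = 0"
      proof (cases "q = 0 \<or> a = 0")
        case False
        then have "degree h + degree q < n" "d + degree a < n"
          using degr dega \<open>g \<noteq> 0\<close> \<open>h \<noteq> 0\<close> by (simp_all add: q degree_mult_eq d_def)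
        \<comment> \<open>Adding the two strict bounds and subtracting d + deg h = n leaves at most
          n - 2.\<close>
        then have "degree (q * a) < n - 1" using deg False by (simp add: degree_mult_eq)
        then show ?thesis by (rule coeff_eq_0)
      qed auto
      ultimately show "coeff (r * (g * a)) (n - 1) = 0" by simp
    qed
  qed
  finally show ?thesis using c by (simp add: dual_code_def r_def)
qed (simp add: dual_code_def)

lemma is_generator_poly_dual_code:
  fixes g :: "'a::field poly"
  assumes "n > 0" and "is_generator_poly n C g"
  shows "is_generator_poly n (dual_code n C) (monic_reciprocal ((monom 1 n - 1) div g))"
proof -
  define h where "h = (monom 1 n - 1) div g"
  have "g dvd monom 1 n - 1" and C: "C = cyclic_code n g"
    using assms(2) by (auto simp: is_generator_poly_def)
  then have gh: "g * h = monom 1 n - 1" by (simp add: h_def)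
  then have "coeff (g * h) 0 \<noteq> 0" using \<open>n > 0\<close> by simp
  then have h0: "coeff h 0 \<noteq> 0" by (auto simp: coeff_mult)
  have unit: "inverse (poly h 0) \<noteq> 0" using h0 by (simp add: poly_0_coeff_0)
  have dvd_iff: "monic_reciprocal h dvd p \<longleftrightarrow> reflect_poly h dvd p" for p
    using unit by (simp add: monic_reciprocal_def smult_dvd_iff)
  \<comment> \<open>Up to sign x^n - 1 is its own reciprocal, so reciprocals of its divisors divide
    it again.\<close>
  have "reflect_poly (monom 1 n - 1) = 1 - monom (1::'a) n"
  proof (rule poly_eqI)
    fix k
    show "coeff (reflect_poly (monom 1 n - 1)) k = coeff (1 - monom (1::'a) n) k"
      using \<open>n > 0\<close> by (auto simp: coeff_reflect_poly degree_monom_minus_1)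
  qed
  then have "reflect_poly g * reflect_poly h = 1 - monom 1 n"
    by (simp flip: gh reflect_poly_mult)
  then have "reflect_poly h dvd - (1 - monom 1 n)" by (metis dvd_minus_iff dvd_triv_right)
  then have dvd: "monic_reciprocal h dvd monom 1 n - 1" by (simp add: dvd_iff)
  have "lead_coeff (monic_reciprocal h) = 1"
    using h0 unit by (simp add: monic_reciprocal_def coeff_reflect_poly poly_0_coeff_0)
  moreover have "dual_code n C = cyclic_code n (monic_reciprocal h)"
    by (auto simp: C mem_dual_code_cyclic_code_iff[OF \<open>n > 0\<close> gh] mem_cyclic_code_iff[OF dvd]
        dvd_iff dvd_Poly_rev_iff[OF h0])
  ultimately show ?thesis using dvd by (simp add: is_generator_poly_def h_def)
qed

section \<open>Minimal polynomials\<close>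

text \<open>The difference of two distinct monic candidates of the same degree would be an
  annihilating polynomial of smaller degree.\<close>

lemma is_min_poly_unique:
  assumes "field_hom emb" "is_min_poly emb \<alpha> p" "is_min_poly emb \<alpha> p'"
  shows "p = p'"
proof (rule ccontr)
  interpret field_hom emb by fact
  interpret P: map_poly_inj_idom_hom emb ..
  assume "p \<noteq> p'"
  have deg: "degree p = degree p'" and lc: "lead_coeff p = 1" "lead_coeff p' = 1"
    using assms unfolding is_min_poly_def by (metis antisym leading_coeff_0_iff zero_neq_one)+
  have "poly (map_poly emb (p - p')) \<alpha> = 0"
    using assms by (simp add: is_min_poly_def hom_distribs)
  with \<open>p \<noteq> p'\<close> assms have "degree p \<le> degree (p - p')" by (simp add: is_min_poly_def)
  moreover have "coeff (p - p') (degree p) = 0" using lc deg by simp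
  moreover have "degree (p - p') \<le> degree p" using deg by (simp add: degree_diff_le)
  ultimately show False using \<open>p \<noteq> p'\<close> by (metis antisym leading_coeff_0_iff right_minus_eq)
qed

text \<open>An annihilating polynomial of least degree exists and can be scaled to be monic;
  uniqueness then justifies the definite description.\<close>

lemma is_min_poly_min_poly:
  assumes "field_hom emb" "r \<noteq> 0" "poly (map_poly emb r) \<alpha> = 0"
  shows "is_min_poly emb \<alpha> (min_poly emb \<alpha>)"
proof -
  interpret field_hom emb by fact
  interpret P: map_poly_inj_idom_hom emb ..
  define P where "P r \<longleftrightarrow> r \<noteq> 0 \<and> poly (map_poly emb r) \<alpha> = 0" for r
  obtain p where p: "P p" "\<And>r. P r \<Longrightarrow> degree p \<le> degree r"
    using ex_has_least_nat[of P r degree] assms by (auto simp: P_def)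
  define p' where "p' = Polynomial.smult (inverse (lead_coeff p)) p"
  have *: "is_min_poly emb \<alpha> p'"
    using p by (auto simp: is_min_poly_def p'_def P_def hom_distribs)
  show ?thesis
    unfolding min_poly_def by (rule theI[of "is_min_poly emb \<alpha>", OF *]) (rule is_min_poly_unique[OF assms(1) _ *])
qed

lemma min_poly_dvd:
  assumes "field_hom emb" "poly (map_poly emb r) \<alpha> = 0"
  shows "min_poly emb \<alpha> dvd r"
proof (cases "r = 0")
  case False
  interpret field_hom emb by fact
  interpret P: map_poly_inj_idom_hom emb ..
  define p where "p = min_poly emb \<alpha>"
  have p: "is_min_poly emb \<alpha> p"
    unfolding p_def using assms False by (intro is_min_poly_min_poly)
  have "p \<noteq> 0" using p by (auto simp: is_min_poly_def)
  have "r mod p = r - r div p * p" by (simp add: minus_div_mult_eq_mod)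
  then have "poly (map_poly emb (r mod p)) \<alpha> = 0"
    using p assms by (simp add: is_min_poly_def hom_distribs)
  with p have "r mod p \<noteq> 0 \<Longrightarrow> degree p \<le> degree (r mod p)" by (simp add: is_min_poly_def)
  with \<open>p \<noteq> 0\<close> have "r mod p = 0" using degree_mod_less'[of p r] by linarith
  then show ?thesis by (auto simp: p_def)
qed simp

section \<open>Conjugates over the field with two elements\<close>

lemma field_of_order_2:
  assumes "CARD('a::{finite,field}) = 2"
  shows "(UNIV :: 'a set) = {0, 1}" and "(2 :: 'a) = 0"
proof -
  have "{0, 1} = (UNIV :: 'a set)" using assms by (intro card_subset_eq) auto
  then show UNIV: "(UNIV :: 'a set) = {0, 1}" ..
  have "(2 :: 'a) \<in> {0, 1}" unfolding UNIV[symmetric] by simp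
  then show "(2 :: 'a) = 0"
    by (metis add_cancel_right_left insertE one_add_one singletonD zero_neq_one)
qed

lemma root_min_poly_binary:
  fixes emb :: "'k::{finite,field} \<Rightarrow> 'e::field"
  assumes "CARD('k) = 2" "field_hom emb" "m > 0" "\<alpha> ^ 2 ^ m = \<alpha>"
    and root: "poly (map_poly emb (min_poly emb \<alpha>)) \<gamma> = 0"
  shows "\<exists>l<m. \<gamma> = \<alpha> ^ 2 ^ l"
proof -
  interpret emb: field_hom emb by fact
  interpret embP: map_poly_inj_idom_hom emb ..
  have two: "(2 :: 'e) = 0"
    using emb.hom_numeral[of "num.Bit0 num.One"] field_of_order_2(2)[OF assms(1)] by simp
  then have uminus: "- x = x" for x :: 'e
    by (metis add_eq_0_iff mult_2 mult_zero_left)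
  interpret sq: comm_ring_hom "\<lambda>x :: 'e. x\<^sup>2"
    by unfold_locales (simp_all add: power2_sum two power_mult_distrib)
  interpret sqP: map_poly_comm_ring_hom "\<lambda>x :: 'e. x\<^sup>2" ..
  \<comment> \<open>The product over the conjugates of \<open>\<alpha>\<close> is fixed by the Frobenius map, so its coefficients
    are roots of \<open>x\<^sup>2 = x\<close> and it comes from the ground field.\<close>
  define f where "f l = [:- (\<alpha> ^ 2 ^ l), 1:]" for l
  define P where "P = (\<Prod>l<m. f l)"
  have "map_poly (\<lambda>x. x\<^sup>2) (f l) = f (Suc l)" for l
    by (simp add: f_def uminus hom_distribs power_mult[symmetric] mult.commute)
  then have "map_poly (\<lambda>x. x\<^sup>2) P = (\<Prod>l<m. f (Suc l))"
    by (simp add: P_def sqP.hom_prod)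
  \<comment> \<open>The shift trades the factor \<open>f 0\<close> for \<open>f m\<close>, and the
    two agree because \<open>\<alpha> ^ 2 ^ m = \<alpha>\<close>.\<close>
  moreover have "f 0 * (\<Prod>l<m. f (Suc l)) = f 0 * P"
    using prod.lessThan_Suc_shift[of f m] assms(4) by (simp add: P_def f_def mult.commute)
  moreover have "f 0 \<noteq> 0" by (simp add: f_def)
  ultimately have P: "map_poly (\<lambda>x. x\<^sup>2) P = P" by simp
  have "coeff P i \<in> range emb" for i
  proof -
    have "(coeff P i)\<^sup>2 = coeff P i" by (metis P sq.coeff_map_poly_hom)
    then have "coeff P i = 0 \<or> coeff P i = 1" by (auto simp: power2_eq_square)
    then show ?thesis by (metis emb.hom_zero emb.hom_one rangeI)
  qed
  then have "\<forall>i. \<exists>c. emb c = coeff P i" by (metis rangeE)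
  then obtain c where c: "emb (c i) = coeff P i" for i by metis
  define r where "r = Poly (map c [0..<Suc (degree P)])"
  have r: "map_poly emb r = P"
  proof (rule poly_eqI)
    fix i show "coeff (map_poly emb r) i = coeff P i"
      using c coeff_eq_0[of P i] by (auto simp: r_def nth_default_def simp del: upt_Suc)
  qed
  have "poly P \<alpha> = 0" by (auto simp: P_def poly_prod f_def intro!: bexI[of _ 0] \<open>m > 0\<close>)
  then have "min_poly emb \<alpha> dvd r" using assms(2) r by (intro min_poly_dvd) auto
  then obtain a where "r = min_poly emb \<alpha> * a" ..
  then have "P = map_poly emb (min_poly emb \<alpha>) * map_poly emb a" using r embP.hom_mult by metis
  with root have "poly P \<gamma> = 0" by simp
  then show ?thesis by (auto simp: P_def poly_prod f_def)
qed

section \<open>Arithmetic of 2-cyclotomic cosets modulo 2^m - 1\<close>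

lemma cyclotomic_coset_gap:
  fixes q i j l :: nat
  defines "Q \<equiv> (2::nat) ^ q"
  assumes "q \<ge> 1" "l < 2 * q + 3" and j: "1 \<le> j" "j + 4 \<le> 4 * Q"
    and i: "i + 4 \<le> 8 * Q \<or> q = 1 \<and> i = 13" "i \<noteq> 4 * Q - 1"
  shows "\<not> 2 ^ (2 * q + 3) - 1 dvd i + j * 2 ^ l"
proof
  assume dvd: "2 ^ (2 * q + 3) - 1 dvd i + j * 2 ^ l"
  have "(2::nat) ^ 1 \<le> Q" unfolding Q_def using \<open>q \<ge> 1\<close> by (intro power_increasing) auto
  then have Q2: "2 \<le> Q" by simp
  then have QQ: "2 * Q \<le> Q * Q" by simp
  have m: "(2::nat) ^ (2 * q + 3) = 8 * (Q * Q)"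
    unfolding Q_def power_add power_mult_distrib[symmetric] power_mult by (simp add: power_mult_distrib power2_eq_square)
  \<comment> \<open>For \<open>q = 1\<close> the exceptional index 13 equals 8Q - 3, so one bound
    covers both alternatives.\<close>
  have i': "i + 3 \<le> 8 * Q" using i(1) by (auto simp: Q_def)
  show False
  proof (cases "l \<le> q")
    case True
    then have "(2::nat) ^ l \<le> Q" unfolding Q_def by (intro power_increasing) auto
    then have "(j + 4) * 2 ^ l \<le> 4 * Q * Q" using j(2) by (intro mult_mono) auto
    moreover have "(1::nat) \<le> 2 ^ l" by simp
    ultimately have "j * 2 ^ l + 4 \<le> 4 * (Q * Q)"
      unfolding distrib_right mult.assoc by linarith
    moreover have "1 \<le> j * 2 ^ l" using j(1) by simp
    \<comment> \<open>By 2Q <= Q^2, \<open>i\<close> is below 4Q^2 as well, so the sum lies strictly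
      between 0 and the divisor.\<close>
    ultimately have "0 < i + j * 2 ^ l" "i + j * 2 ^ l < 8 * (Q * Q) - 1"
      using i' QQ by linarith+
    with dvd show False using m nat_dvd_not_less by metis
  next
    case False
    \<comment> \<open>Multiplying by \<open>2 ^ s\<close> with \<open>l + s = 2 * q + 3\<close> moves the large power of two from
      \<open>j\<close> to \<open>i\<close>, since \<open>2 ^ (l + s)\<close> is 1 modulo the divisor.\<close>
    define s where "s = 2 * q + 3 - l"
    define S where "S = (2::nat) ^ s"
    have s: "1 \<le> s" "s \<le> q + 2" "l + s = 2 * q + 3" using False assms(3) by (auto simp: s_def)
    have "(i + j * 2 ^ l) * S = (i * S + j) + j * (8 * (Q * Q) - 1)"
    proof -
      have "2 ^ l * S = 8 * (Q * Q)" unfolding S_def m[symmetric] s(3)[symmetric] power_add ..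
      moreover have "j * (8 * (Q * Q) - 1) + j = j * (8 * (Q * Q))"
        using Q2 by (simp add: algebra_simps)
      ultimately show ?thesis by (simp add: distrib_right mult.assoc)
    qed
    moreover have "8 * (Q * Q) - 1 dvd (i + j * 2 ^ l) * S" using dvd m by simp
    ultimately have "8 * (Q * Q) - 1 dvd i * S + j"
      by (metis dvd_add_left_iff dvd_triv_right)
    then obtain t where t0: "i * S + j = (8 * (Q * Q) - 1) * t" ..
    then have t: "i * S + j + t = 8 * (Q * Q) * t"
      using Q2 by (simp add: diff_mult_distrib)
    then have "t \<noteq> 0" using j(1) by (intro notI) simp
    show False
    proof (cases "s = q + 2")
      case True
      then have S: "S = 4 * Q" by (simp add: S_def Q_def)
      have "(i + 3) * S \<le> 8 * Q * (4 * Q)" using i' S by (intro mult_mono) auto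
      then have "i * S + 12 * Q \<le> 32 * (Q * Q)" by (simp add: S algebra_simps)
      then have "t < 4"
        using t0 j Q2 mult_le_mono2[of 4 t "8 * (Q * Q) - 1"] by linarith
      have "S * (2 * Q * t) = S * i + (j + t)" using t by (simp add: S algebra_simps)
      then have "S dvd j + t" by (metis dvd_add_right_iff dvd_triv_left)
      \<comment> \<open>But \<open>j + t\<close> is at most (4Q - 4) + 3 = S - 1.\<close>
      then have "S \<le> j + t" using j by (intro dvd_imp_le) auto
      then show False using \<open>t < 4\<close> S j by linarith
    next
      case False
      then have "s \<le> q + 1" using s by simp
      then have "S \<le> 2 ^ (q + 1)" unfolding S_def by (intro power_increasing) auto
      then have "S \<le> 2 * Q" by (simp add: Q_def)
      then have "i * S \<le> i * (2 * Q)" by (rule mult_le_mono2)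
      moreover have "(i + 3) * (2 * Q) \<le> 8 * Q * (2 * Q)" using i' by (rule mult_le_mono1)
      moreover have "(i + 3) * (2 * Q) = i * (2 * Q) + 6 * Q" by (simp add: distrib_right)
      moreover have "8 * Q * (2 * Q) = 16 * (Q * Q)" by simp
      ultimately have "i * S + 6 * Q \<le> 16 * (Q * Q)" by linarith
      then have "t < 2"
        using t0 j Q2 mult_le_mono2[of 2 t "8 * (Q * Q) - 1"] by linarith
      with \<open>t \<noteq> 0\<close> t have t1: "i * S + (j + 1) = 8 * (Q * Q)" by (simp add: less_2_cases_iff)
      have split: "8 * (Q * Q) = S * 2 ^ l"
        by (simp add: S_def m[symmetric] s(3)[symmetric] power_add)
      \<comment> \<open>With t = 1, \<open>S\<close> must divide \<open>j + 1\<close>; cancelling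
        \<open>S\<close> turns the equation into i + k = 2^l with k = (j + 1) / S.\<close>
      have "S dvd j + 1" using t1 split by (metis dvd_add_right_iff dvd_triv_left dvd_triv_right)
      then obtain k where k: "j + 1 = S * k" ..
      have "S > 0" by (simp add: S_def)
      have "S * (i + k) = S * 2 ^ l" using t1 k split by (simp add: algebra_simps)
      with \<open>S > 0\<close> have ik: "i + k = 2 ^ l" by simp
      have "k \<noteq> 0" using k by (intro notI) simp
      consider "s = q + 1" | "s = q" | "s + 1 \<le> q" using \<open>s \<le> q + 1\<close> by linarith
      then show False
      proof cases
        case 1
        \<comment> \<open>Here k = 1, which gives precisely the excluded index 4Q - 1.\<close>
        then have "S = 2 * Q" "l = q + 2" using s by (auto simp: S_def Q_def)
        then have "i + k = 4 * Q" using ik by (simp add: Q_def)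
        moreover have "k < 2"
          using k j \<open>S = 2 * Q\<close> mult_le_mono2[of 2 k S] by linarith
        ultimately show False using i(2) \<open>k \<noteq> 0\<close> by simp
      next
        case 2
        \<comment> \<open>Here \<open>k\<close> is at most 3, so \<open>i\<close> is at least 8Q -
          3. Only the exceptional i = 13 with Q = 2 reaches this; it needs k = 3, hence j = 5, while
          \<open>j\<close> is at most 4.\<close>
        then have "S = Q" "l = q + 3" using s by (auto simp: S_def Q_def)
        then have "i + k = 8 * Q" using ik by (simp add: Q_def power_add)
        moreover have "k < 4"
          using k j \<open>S = Q\<close> mult_le_mono2[of 4 k S] by linarith
        ultimately have "q = 1" "i = 13" using i(1) by auto
        then show False using \<open>i + k = 8 * Q\<close> k j \<open>S = Q\<close> by (simp add: Q_def)
      next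
        case 3
        \<comment> \<open>Now 2^l is at least 16Q, but \<open>i + k\<close> stays below 12Q.\<close>
        then have "(2::nat) ^ (q + 4) \<le> 2 ^ l" using s by (intro power_increasing) auto
        then have "16 * Q \<le> i + k" using ik by (simp add: Q_def power_add)
        moreover have "k \<le> S * k" using \<open>S > 0\<close> by simp
        ultimately show False using k j i' Q2 by linarith
      qed
    qed
  qed
qed

section \<open>Roots of the generator polynomial of a BCH code\<close>

text \<open>The remainder of \<open>f\<close> modulo x^n - 1 is a codeword, hence a multiple of
  \<open>g\<close>, and \<open>g\<close> divides the modulus too.\<close>

lemma generator_poly_dvd:
  assumes "n > 0" "is_generator_poly n (cyclic_code n f) g"
  shows "g dvd f"
proof -
  define M where "M = monom 1 n - (1 :: 'a poly)"
  have g: "g dvd M" "cyclic_code n f = cyclic_code n g"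
    using assms(2) by (auto simp: is_generator_poly_def M_def)
  have "degree M = n" using degree_monom_minus_1[OF \<open>n > 0\<close>] by (simp add: M_def)
  moreover from this have "M \<noteq> 0" using \<open>n > 0\<close> by auto
  ultimately have "degree (f mod M) < n"
    using degree_mod_less[of M f] \<open>n > 0\<close> by auto
  then have word: "Poly (list_of_vec (vec n (coeff (f mod M)))) = f mod M"
    by (simp add: Poly_map_coeff)
  then have "[Poly (list_of_vec (vec n (coeff (f mod M)))) = 1 * f] (mod M)"
    by (simp add: cong_def)
  then have "vec n (coeff (f mod M)) \<in> cyclic_code n f"
    unfolding cyclic_code_def M_def mem_Collect_eq by (intro conjI exI vec_carrier)
  then have "g dvd f mod M"
    using g mem_cyclic_code_iff[of g n] word by (simp add: M_def)
  with g(1) show ?thesis by (simp add: dvd_mod_iff)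
qed

lemma root_bch_generator_poly:
  fixes emb :: "'k::{finite,field_gcd} \<Rightarrow> 'e::field"
  assumes "CARD('k) = 2" "field_hom emb" "n > 0" "m > 0" "\<beta> ^ 2 ^ m = \<beta>"
    and "is_generator_poly n (bch_code emb n \<delta> 1 \<beta>) g"
    and root: "poly (map_poly emb g) \<gamma> = 0"
  obtains j l where "1 \<le> j" "int j < \<delta>" "l < m" "\<gamma> = \<beta> ^ (j * 2 ^ l)"
proof -
  interpret emb: field_hom emb by fact
  interpret embP: map_poly_inj_idom_hom emb ..
  let ?f = "\<lambda>i. min_poly emb (\<beta> powi i)"
  have "g dvd Lcm (?f ` {1..1 + \<delta> - 2})"
    using assms generator_poly_dvd by (simp add: bch_code_def)
  \<comment> \<open>Only an upper bound on the set of roots is wanted, so the lcm may be replaced by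
    the product, whose evaluation splits into factors.\<close>
  also have "Lcm (?f ` {1..1 + \<delta> - 2}) dvd (\<Prod>i\<in>{1..1 + \<delta> - 2}. ?f i)"
    by (auto simp: Lcm_dvd_iff intro!: dvd_prodI)
  finally obtain a where "(\<Prod>i\<in>{1..1 + \<delta> - 2}. ?f i) = g * a" ..
  then have "map_poly emb (\<Prod>i\<in>{1..1 + \<delta> - 2}. ?f i) = map_poly emb g * map_poly emb a"
    by (metis embP.hom_mult)
  with root have "poly (map_poly emb (\<Prod>i\<in>{1..1 + \<delta> - 2}. ?f i)) \<gamma> = 0" by simp
  then obtain i where i: "i \<in> {1..1 + \<delta> - 2}" "poly (map_poly emb (?f i)) \<gamma> = 0"
    by (auto simp: embP.hom_prod poly_prod)
  define j where "j = nat i"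
  have j: "\<beta> powi i = \<beta> ^ j" using i by (simp add: j_def power_int_def)
  have "(\<beta> ^ j) ^ 2 ^ m = \<beta> ^ j" using assms(5) by (metis power_mult mult.commute)
  then obtain l where "l < m" "\<gamma> = (\<beta> ^ j) ^ 2 ^ l"
    using root_min_poly_binary[of emb m "\<beta> ^ j" \<gamma>] assms i j by auto
  then show ?thesis using that[of j l] i by (auto simp: j_def power_mult)
qed

lemma primitive_root_power_eq_1_iff:
  assumes "primitive_root_of_unity n \<beta>"
  shows "\<beta> ^ k = 1 \<longleftrightarrow> n dvd k"
proof -
  have n: "n > 0" "\<beta> ^ n = 1" "\<And>k. 0 < k \<Longrightarrow> k < n \<Longrightarrow> \<beta> ^ k \<noteq> 1"
    using assms by (auto simp: primitive_root_of_unity_def)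
  have "\<beta> ^ k = \<beta> ^ (k mod n)"
    using n(2) by (metis div_mult_mod_eq mult.commute mult_1 power_add power_mult power_one)
  then show ?thesis using n by (metis dvd_eq_mod_eq_0 mod_less_divisor neq0_conv power_0)
qed

lemma (in field_hom) map_poly_reflect_poly:
  "map_poly hom (reflect_poly p) = reflect_poly (map_poly hom p)"
  by (intro poly_eqI) (simp add: coeff_reflect_poly)

lemma root_monic_reciprocal:
  assumes "field_hom emb" "x \<noteq> 0" "poly (map_poly emb h) (inverse x) = 0"
  shows "poly (map_poly emb (monic_reciprocal h)) x = 0"
proof -
  interpret field_hom emb by fact
  show ?thesis using assms(2,3)
    by (simp add: monic_reciprocal_def hom_distribs map_poly_reflect_poly poly_reflect_poly_nz)
qed

section \<open>The defining set of the dual code\<close>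

theorem theorem5:
  fixes emb :: "'k::{finite,field_gcd} \<Rightarrow> 'e::{finite,field}"
    and m n :: nat and \<delta> :: int and \<beta> :: 'e
    and C :: "'k vec set" and g h gperp :: "'k poly" and T :: "nat set"
  assumes "CARD('k) = 2" and "CARD('e) = 2 ^ m" and "field_hom emb"
    and "odd m"
    and "n = 2 ^ m - 1"
    and "primitive_root_of_unity n \<beta>"
    and "\<delta> = 2 ^ ((m + 1) div 2) - 3" and "\<delta> \<ge> 2"
    and "C = bch_code emb n \<delta> 1 \<beta>"
    and "is_generator_poly n C g"
    and "h = (monom 1 n - 1) div g"
    and "gperp = monic_reciprocal h"
    and "T = defining_set emb n \<beta> gperp"
    and "m \<ge> 5"
  shows "is_generator_poly n (dual_code n C) gperp
    \<and> {0..2 ^ ((m + 1) div 2) - 2} \<union> {2 ^ ((m + 1) div 2)..2 ^ ((m + 3) div 2) - 4} \<subseteq> T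
    \<and> (m = 5 \<longrightarrow> 2 ^ ((m + 3) div 2) - 3 \<in> T)"
proof -
  interpret emb: field_hom emb by fact
  interpret embP: map_poly_inj_idom_hom emb ..
  obtain k where "m = 2 * k + 1" using \<open>odd m\<close> by (rule oddE)
  then have "m = 2 * (k - 1) + 3" "k - 1 \<ge> 1" using \<open>m \<ge> 5\<close> by auto
  then obtain q where q: "m = 2 * q + 3" "q \<ge> 1" by blast
  define Q where "Q = (2::nat) ^ q"
  have "(2::nat) ^ 1 \<le> Q" unfolding Q_def using q by (intro power_increasing) auto
  then have Q2: "Q \<ge> 2" by simp
  have pows: "(2::nat) ^ ((m + 1) div 2) = 4 * Q" "(2::nat) ^ ((m + 3) div 2) = 8 * Q"
    using q by (simp_all add: Q_def power_add)
  have "(2::int) ^ ((m + 1) div 2) = 4 * int Q"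
    using q by (simp add: Q_def power_add)
  then have \<delta>: "\<delta> = 4 * int Q - 3" using assms(7) by simp
  have n: "n > 0" "\<beta> ^ n = 1" "\<beta> \<noteq> 0"
    using assms(6) by (auto simp: primitive_root_of_unity_def power_0_left)
  have "Suc n = 2 ^ m" using assms(5) by simp
  then have \<beta>: "\<beta> ^ 2 ^ m = \<beta>" using n by (metis mult_1_right power_Suc)
  \<comment> \<open>This puts all indices up to 8Q - 3 below \<open>n\<close>, as membership in the
    defining set requires.\<close>
  have "(2::nat) ^ (q + 4) \<le> 2 ^ m" using q by (intro power_increasing) auto
  then have n_large: "16 * Q \<le> Suc n" using \<open>Suc n = 2 ^ m\<close> by (simp add: Q_def power_add)
  \<comment> \<open>The second alternative is the extra index for m = 5, where Q = 2 and 8Q - 3 =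
    13.\<close>
  have T: "i \<in> T" if i: "i + 4 \<le> 8 * Q \<or> q = 1 \<and> i = 13" "i \<noteq> 4 * Q - 1" for i
  proof -
    define \<gamma> where "\<gamma> = inverse (\<beta> ^ i)"
    have "poly (map_poly emb g) \<gamma> \<noteq> 0"
    proof
      assume "poly (map_poly emb g) \<gamma> = 0"
      then obtain j l where jl: "1 \<le> j" "int j < \<delta>" "l < m" "\<gamma> = \<beta> ^ (j * 2 ^ l)"
        using root_bch_generator_poly[of emb n m \<beta> \<delta> g \<gamma>] assms n \<beta> by auto
      then have "\<beta> ^ (i + j * 2 ^ l) = 1" using n by (simp add: \<gamma>_def power_add flip: jl(4))
      then have "n dvd i + j * 2 ^ l"
        using primitive_root_power_eq_1_iff[OF assms(6)] by blast
      moreover have "j + 4 \<le> 4 * Q" using jl(2) \<delta> by linarith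
      ultimately show False
        using cyclotomic_coset_gap[of q l j i] q i jl assms(5) by (simp add: Q_def)
    qed
    \<comment> \<open>As an n-th root of unity, \<open>\<gamma>\<close> is a root of g * h; not
      being a root of \<open>g\<close>, it is one of \<open>h\<close>, and its inverse is a root of
      the reciprocal.\<close>
    moreover have "poly (map_poly emb g) \<gamma> * poly (map_poly emb h) \<gamma> = 0"
    proof -
      have "g * h = monom 1 n - 1" using assms(10,11) by (simp add: is_generator_poly_def)
      then have "map_poly emb g * map_poly emb h = monom 1 n - 1"
        by (simp add: hom_distribs flip: embP.hom_mult)
      moreover have "\<gamma> ^ n = 1"
        using n(2) unfolding \<gamma>_def power_inverse by (metis inverse_1 mult.commute power_mult power_one)
      ultimately show ?thesis by (simp add: poly_monom flip: poly_mult)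
    qed
    ultimately have "poly (map_poly emb gperp) (\<beta> ^ i) = 0"
      using root_monic_reciprocal[OF assms(3), of "\<beta> ^ i" h] n assms(12) by (simp add: \<gamma>_def)
    moreover have "i < n" using i n_large Q2 by (auto simp: Q_def)
    ultimately show ?thesis using assms(13) by (simp add: defining_set_def)
  qed
  have "is_generator_poly n (dual_code n C) gperp"
    using is_generator_poly_dual_code[OF n(1) assms(10)] assms(11,12) by simp
  moreover have "{0..2 ^ ((m + 1) div 2) - 2} \<union> {2 ^ ((m + 1) div 2)..2 ^ ((m + 3) div 2) - 4} \<subseteq> T"
    unfolding pows using Q2 by (intro subsetI T) auto
  moreover have "2 ^ ((m + 3) div 2) - 3 \<in> T" if "m = 5"
    unfolding pows using that q by (intro T) (auto simp: Q_def)
  ultimately show ?thesis by blast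
qed

end
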